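(* Let $I=\{0,1\}\times\mathbb{N}$, let $\mathfrak{G}$ be the group of all permutations $\pi$ of $I$ that map $\{0\}\times\mathbb{N}$ onto itself and $\{1\}\times\mathbb{N}$ onto itself, and let $2\Sigma_0$ be the predicate structure $(J_n)_{n\ge0}$ with $J_0=I$ and, for $n\ge1$, $J_n$ the set of all $n$-ary predicates $\alpha$ on $I$ for which there is a finite set $P\subseteq I$ such that $\alpha^\pi=\alpha$ for every $\pi\in\mathfrak{G}$ fixing each element of $P$. Then: (1) $2\Sigma_0\models\neg TR^n$ for all $n\ge1$. (2) $2\Sigma_0\models\neg LO^n$ for all $n\ge1$. (3) $2\Sigma_0\models choice_h^{n,m}$ for all $n,m\ge1$.
   Context: Predicates: an $n$-ary predicate on $I$ is a function $\alpha:I^n\to\{true,false\}$; for a permutation $\pi$ of $I$, $\alpha^\pi(\xi_1,\ldots,\xi_n)=\alpha(\pi^{-1}(\xi_1),\ldots,\pi^{-1}(\xi_n))$. Second-order language and Henkin semantics: there are individual variables and, for each $n\ge1$, $n$-ary predicate variables; formulas are built from atomic formulas (predicate variables applied to tuples of individual variables, and identities between variables of the same sort) by the usual connectives and quantification over individual and predicate variables. In a predicate structure $\Sigma=(J_n)_{n\ge0}$, individual variables range over $J_0$ and $n$-ary predicate variables range over $J_n$. $\Sigma\models H$ means that $H$ is true in $\Sigma$ under all assignments of elements of $J_0$ to the individual variables and of elements of $J_n$ to the $n$-ary predicate variables; for a set $\mathcal{G}$ of formulas, $\Sigma\models\mathcal{G}$ means $\Sigma\models H$ for all $H\in\mathcal{G}$.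 The principles ($\boldsymbol{x},\boldsymbol{y}$ denote tuples of individual variables of the appropriate length): $TR^n$ (trichotomy) is the sentence saying that for all $n$-ary predicates $A,B$ there is a $2n$-ary predicate which is (the graph of) an injective mapping of $A$ into $B$, or there is a $2n$-ary predicate which is (the graph of) an injective mapping of $B$ into $A$ (here $A,B$ are identified with sets of $n$-tuples). $LO^n$ (linear ordering) is the sentence saying that for every $n$-ary predicate $A$ there is a $2n$-ary predicate $T$ that is a linear (total) ordering of the set of $n$-tuples satisfying $A$. $choice_h^{n,m}$ (Hilbert–Ackermann axioms of choice) is the set of all formulas $$\forall\boldsymbol{x}\,\exists D\,H(\boldsymbol{x},D)\;\to\;\exists S\,\forall\boldsymbol{x}\,\exists D\,\bigl(\forall\boldsymbol{y}\,(D\boldsymbol{y}\leftrightarrow S\boldsymbol{x}\boldsymbol{y})\wedge H(\boldsymbol{x},D)\bigr),$$ where $\boldsymbol{x}$ is an $n$-tuple and $\boldsymbol{y}$ an $m$-tuple of distinct individual variables, $D$ is an $m$-ary and $S$ an $(n+m)$-ary predicate variable, and $H(\boldsymbol{x},D)$ is any second-order formula, possibly with further free individual and predicate variables as parameters, in which $S$ and the variables $\boldsymbol{y}$ do not occur. *)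

theory Defs
  imports Main "HOL-Combinatorics.Permutations"
begin

section \<open>Second-order formulas\<close>

type_synonym ivar = nat

datatype pvar = PVar (arity: nat) nat

datatype form =
    Atom pvar "ivar list"
  | IEq ivar ivar
  | PEq pvar pvar
  | Neg form
  | Conj form form
  | Disj form form
  | Imp form form
  | Iff form form
  | AllI ivar form
  | ExI ivar form
  | AllP pvar form
  | ExP pvar form

text \<open>The datatype alone admits ill-sorted expressions; \<open>wf_form\<close> singles out the genuine formulas,
  in which all predicate variables have arity at least 1.\<close>

fun wf_form :: "form \<Rightarrow> bool" where
  "wf_form (Atom P xs) \<longleftrightarrow> arity P \<ge> 1 \<and> length xs = arity P"
| "wf_form (IEq x y) \<longleftrightarrow> True"
| "wf_form (PEq P Q) \<longleftrightarrow> arity P \<ge> 1 \<and> arity Q = arity P"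
| "wf_form (Neg H) \<longleftrightarrow> wf_form H"
| "wf_form (Conj G H) \<longleftrightarrow> wf_form G \<and> wf_form H"
| "wf_form (Disj G H) \<longleftrightarrow> wf_form G \<and> wf_form H"
| "wf_form (Imp G H) \<longleftrightarrow> wf_form G \<and> wf_form H"
| "wf_form (Iff G H) \<longleftrightarrow> wf_form G \<and> wf_form H"
| "wf_form (AllI x H) \<longleftrightarrow> wf_form H"
| "wf_form (ExI x H) \<longleftrightarrow> wf_form H"
| "wf_form (AllP P H) \<longleftrightarrow> arity P \<ge> 1 \<and> wf_form H"
| "wf_form (ExP P H) \<longleftrightarrow> arity P \<ge> 1 \<and> wf_form H"

text \<open>All occurring variables, whether free, bound or merely quantified.\<close>

fun ivars :: "form \<Rightarrow> ivar set" where
  "ivars (Atom P xs) = set xs"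
| "ivars (IEq x y) = {x, y}"
| "ivars (PEq P Q) = {}"
| "ivars (Neg H) = ivars H"
| "ivars (Conj G H) = ivars G \<union> ivars H"
| "ivars (Disj G H) = ivars G \<union> ivars H"
| "ivars (Imp G H) = ivars G \<union> ivars H"
| "ivars (Iff G H) = ivars G \<union> ivars H"
| "ivars (AllI x H) = insert x (ivars H)"
| "ivars (ExI x H) = insert x (ivars H)"
| "ivars (AllP P H) = ivars H"
| "ivars (ExP P H) = ivars H"

fun pvars :: "form \<Rightarrow> pvar set" where
  "pvars (Atom P xs) = {P}"
| "pvars (IEq x y) = {}"
| "pvars (PEq P Q) = {P, Q}"
| "pvars (Neg H) = pvars H"
| "pvars (Conj G H) = pvars G \<union> pvars H"
| "pvars (Disj G H) = pvars G \<union> pvars H"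
| "pvars (Imp G H) = pvars G \<union> pvars H"
| "pvars (Iff G H) = pvars G \<union> pvars H"
| "pvars (AllI x H) = pvars H"
| "pvars (ExI x H) = pvars H"
| "pvars (AllP P H) = insert P (pvars H)"
| "pvars (ExP P H) = insert P (pvars H)"

section \<open>Predicate structures and Henkin semantics\<close>

text \<open>An \<open>n\<close>-ary predicate on \<open>I\<close> is represented by its extension by \<open>False\<close> from \<open>I\<^sup>n\<close> to all
  lists, so that equality of representations is equality of predicates.\<close>

definition nary_preds :: "'a set \<Rightarrow> nat \<Rightarrow> ('a list \<Rightarrow> bool) set" where
  "nary_preds I n = {\<alpha>. \<forall>xs. \<alpha> xs \<longrightarrow> length xs = n \<and> set xs \<subseteq> I}"

text \<open>\<open>indivs\<close> is \<open>J\<^sub>0\<close>, and \<open>preds n\<close> is \<open>J\<^sub>n\<close> for \<open>n \<ge> 1\<close>; the value \<open>preds 0\<close> is irrelevant.\<close>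

record 'a pred_structure =
  indivs :: "'a set"
  preds :: "nat \<Rightarrow> ('a list \<Rightarrow> bool) set"

fun satisfies ::
  "'a pred_structure \<Rightarrow> (ivar \<Rightarrow> 'a) \<Rightarrow> (pvar \<Rightarrow> 'a list \<Rightarrow> bool) \<Rightarrow> form \<Rightarrow> bool" where
  "satisfies \<Sigma> e f (Atom P xs) \<longleftrightarrow> f P (map e xs)"
| "satisfies \<Sigma> e f (IEq x y) \<longleftrightarrow> e x = e y"
| "satisfies \<Sigma> e f (PEq P Q) \<longleftrightarrow> f P = f Q"
| "satisfies \<Sigma> e f (Neg H) \<longleftrightarrow> \<not> satisfies \<Sigma> e f H"
| "satisfies \<Sigma> e f (Conj G H) \<longleftrightarrow> satisfies \<Sigma> e f G \<and> satisfies \<Sigma> e f H"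
| "satisfies \<Sigma> e f (Disj G H) \<longleftrightarrow> satisfies \<Sigma> e f G \<or> satisfies \<Sigma> e f H"
| "satisfies \<Sigma> e f (Imp G H) \<longleftrightarrow> (satisfies \<Sigma> e f G \<longrightarrow> satisfies \<Sigma> e f H)"
| "satisfies \<Sigma> e f (Iff G H) \<longleftrightarrow> (satisfies \<Sigma> e f G \<longleftrightarrow> satisfies \<Sigma> e f H)"
| "satisfies \<Sigma> e f (AllI x H) \<longleftrightarrow> (\<forall>a\<in>indivs \<Sigma>. satisfies \<Sigma> (e(x := a)) f H)"
| "satisfies \<Sigma> e f (ExI x H) \<longleftrightarrow> (\<exists>a\<in>indivs \<Sigma>. satisfies \<Sigma> (e(x := a)) f H)"
| "satisfies \<Sigma> e f (AllP P H) \<longleftrightarrow> (\<forall>\<alpha>\<in>preds \<Sigma> (arity P). satisfies \<Sigma> e (f(P := \<alpha>)) H)"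
| "satisfies \<Sigma> e f (ExP P H) \<longleftrightarrow> (\<exists>\<alpha>\<in>preds \<Sigma> (arity P). satisfies \<Sigma> e (f(P := \<alpha>)) H)"

definition models :: "'a pred_structure \<Rightarrow> form \<Rightarrow> bool" where
  "models \<Sigma> H \<longleftrightarrow>
    (\<forall>e f. (\<forall>x. e x \<in> indivs \<Sigma>) \<and> (\<forall>P. arity P \<ge> 1 \<longrightarrow> f P \<in> preds \<Sigma> (arity P))
      \<longrightarrow> satisfies \<Sigma> e f H)"

definition models_set :: "'a pred_structure \<Rightarrow> form set \<Rightarrow> bool" where
  "models_set \<Sigma> \<G> \<longleftrightarrow> (\<forall>H\<in>\<G>. models \<Sigma> H)"

section \<open>Trichotomy, linear ordering and choice\<close>

definition AllIs :: "ivar list \<Rightarrow> form \<Rightarrow> form" where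
  "AllIs xs H = foldr AllI xs H"

definition ExIs :: "ivar list \<Rightarrow> form \<Rightarrow> form" where
  "ExIs xs H = foldr ExI xs H"

text \<open>Only used for nonempty lists.\<close>

definition Conjs :: "form list \<Rightarrow> form" where
  "Conjs Hs = foldr Conj (butlast Hs) (last Hs)"

definition tuple_eq :: "ivar list \<Rightarrow> ivar list \<Rightarrow> form" where
  "tuple_eq xs ys = Conjs (map2 IEq xs ys)"

text \<open>\<open>F\<close> is the graph of an injective mapping of the set \<open>A\<close> of \<open>n\<close>-tuples into the set \<open>B\<close>:
  \<open>F \<subseteq> A \<times> B\<close>, and \<open>F\<close> is total on \<open>A\<close>, single-valued and injective.\<close>

definition inj_map_form :: "nat \<Rightarrow> pvar \<Rightarrow> pvar \<Rightarrow> pvar \<Rightarrow> form" where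
  "inj_map_form n F A B =
    (let x = [0..<n]; y = [n..<2*n]; z = [2*n..<3*n] in
     Conjs
      [AllIs (x @ y) (Imp (Atom F (x @ y)) (Conj (Atom A x) (Atom B y))),
       AllIs x (Imp (Atom A x) (ExIs y (Atom F (x @ y)))),
       AllIs (x @ y @ z) (Imp (Conj (Atom F (x @ y)) (Atom F (x @ z))) (tuple_eq y z)),
       AllIs (x @ y @ z) (Imp (Conj (Atom F (x @ z)) (Atom F (y @ z))) (tuple_eq x y))])"

definition TR :: "nat \<Rightarrow> form" where
  "TR n =
    (let A = PVar n 0; B = PVar n 1; F = PVar (2*n) 0 in
     AllP A (AllP B
      (Disj (ExP F (inj_map_form n F A B)) (ExP F (inj_map_form n F B A)))))"

text \<open>\<open>T\<close> is a reflexive linear ordering of the set \<open>A\<close> of \<open>n\<close>-tuples, with \<open>T \<subseteq> A \<times> A\<close>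
  (the convention of \<^const>\<open>linear_order_on\<close>).\<close>

definition linear_order_form :: "nat \<Rightarrow> pvar \<Rightarrow> pvar \<Rightarrow> form" where
  "linear_order_form n T A =
    (let x = [0..<n]; y = [n..<2*n]; z = [2*n..<3*n] in
     Conjs
      [AllIs (x @ y) (Imp (Atom T (x @ y)) (Conj (Atom A x) (Atom A y))),
       AllIs x (Imp (Atom A x) (Atom T (x @ x))),
       AllIs (x @ y @ z) (Imp (Conj (Atom T (x @ y)) (Atom T (y @ z))) (Atom T (x @ z))),
       AllIs (x @ y) (Imp (Conj (Atom T (x @ y)) (Atom T (y @ x))) (tuple_eq x y)),
       AllIs (x @ y) (Imp (Conj (Atom A x) (Atom A y)) (Disj (Atom T (x @ y)) (Atom T (y @ x))))])"

definition LO :: "nat \<Rightarrow> form" where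
  "LO n =
    (let A = PVar n 0; T = PVar (2*n) 0 in AllP A (ExP T (linear_order_form n T A)))"

definition choice_h_form ::
  "ivar list \<Rightarrow> ivar list \<Rightarrow> pvar \<Rightarrow> pvar \<Rightarrow> form \<Rightarrow> form" where
  "choice_h_form x y D S H =
    Imp (AllIs x (ExP D H))
        (ExP S (AllIs x (ExP D
          (Conj (AllIs y (Iff (Atom D y) (Atom S (x @ y)))) H))))"

definition choice_h :: "nat \<Rightarrow> nat \<Rightarrow> form set" where
  "choice_h n m =
    {choice_h_form x y D S H | x y D S H.
      length x = n \<and> length y = m \<and> distinct (x @ y) \<and>
      arity D = m \<and> arity S = n + m \<and>
      wf_form H \<and> S \<notin> pvars H \<and> set y \<inter> ivars H = {}}"

section \<open>The structure\<close>

definition pred_act :: "('a \<Rightarrow> 'a) \<Rightarrow> ('a list \<Rightarrow> bool) \<Rightarrow> ('a list \<Rightarrow> bool)" where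
  "pred_act \<pi> \<alpha> = (\<lambda>xs. \<alpha> (map (inv \<pi>) xs))"

definition I2 :: "(nat \<times> nat) set" where
  "I2 = {0, 1} \<times> UNIV"

definition G2 :: "(nat \<times> nat \<Rightarrow> nat \<times> nat) set" where
  "G2 = {\<pi>. \<pi> permutes I2 \<and> \<pi> ` ({0} \<times> UNIV) = {0} \<times> UNIV \<and> \<pi> ` ({1} \<times> UNIV) = {1} \<times> UNIV}"

definition two_Sigma_0 :: "(nat \<times> nat) pred_structure" where
  "two_Sigma_0 =
    \<lparr>indivs = I2,
     preds = (\<lambda>n. {\<alpha> \<in> nary_preds I2 n.
       \<exists>P. finite P \<and> P \<subseteq> I2 \<and>
         (\<forall>\<pi>\<in>G2. (\<forall>p\<in>P. \<pi> p = p) \<longrightarrow> pred_act \<pi> \<alpha> = \<alpha>)})\<rparr>"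

end

theory Submission
  imports Defs
begin

text \<open>
  Every predicate of the structure has a finite support, and truth is invariant under \<open>G2\<close>.
  If \<open>T\<close> is supported by a finite set \<open>P\<close>, exchanging two individuals of the same sort outside \<open>P\<close>
  leaves \<open>T\<close> fixed; this excludes linear orderings of the constant tuples, and injections
  between the constant tuples of the two sorts.

  For choice, let \<open>P\<close> support the parameters of \<open>H\<close>. Up to permutations fixing \<open>P\<close> there are only
  finitely many \<open>n\<close>-tuples, so the solutions \<open>D\<close> of \<open>H(x,D)\<close> can be taken with supports of size at
  most some \<open>k\<close> independent of \<open>x\<close>. Hence one large enough finite set \<open>E\<close> works for all \<open>x\<close>: the
  elements of the support of \<open>D\<close> outside \<open>E\<close> and \<open>x\<close> can be exchanged, one at a time, for unused
  elements of \<open>E\<close>. Now choose a solution supported by \<open>E\<close> and \<open>x\<close> for one \<open>x\<close> in each orbit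
  under the permutations fixing \<open>E\<close>, and transport it along the orbit.
\<close>

section \<open>Semantics of tuples\<close>

text \<open>For a repeated variable \<open>map_of\<close> takes the first match, whereas among
  nested quantifiers the innermost, hence last, occurrence wins. The two agree on distinct
  variables, which explains the distinctness assumptions below.\<close>

definition upd :: "(ivar \<Rightarrow> 'a) \<Rightarrow> ivar list \<Rightarrow> 'a list \<Rightarrow> ivar \<Rightarrow> 'a" where
  "upd e xs as = (\<lambda>v. case map_of (zip xs as) v of None \<Rightarrow> e v | Some a \<Rightarrow> a)"

lemma upd_Nil [simp]: "upd e [] as = e"
  by (simp add: upd_def)

lemma upd_Cons:
  assumes "x \<notin> set xs"
  shows "upd e (x # xs) (a # as) = upd (e(x := a)) xs as"
proof
  fix v
  have "map_of (zip xs as) x = None"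
    using assms by (metis map_of_eq_None_iff in_set_zipE fst_conv imageE prod.collapse)
  then show "upd e (x # xs) (a # as) v = upd (e(x := a)) xs as v"
    by (cases "v = x") (auto simp: upd_def split: option.split)
qed

lemma upd_notin [simp]: "v \<notin> set xs \<Longrightarrow> upd e xs as v = e v"
proof -
  assume "v \<notin> set xs"
  then have "map_of (zip xs as) v = None"
    by (metis map_of_eq_None_iff in_set_zipE fst_conv imageE prod.collapse)
  then show ?thesis
    by (simp add: upd_def)
qed

lemma map_upd_disjoint [simp]: "set xs \<inter> set ys = {} \<Longrightarrow> map (upd e xs as) ys = map e ys"
  by (intro map_cong refl upd_notin) auto

lemma map_upd_same:
  "distinct xs \<Longrightarrow> length as = length xs \<Longrightarrow> map (upd e xs as) xs = as"
proof (induction xs arbitrary: e as)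
  case Nil
  then show ?case by simp
next
  case (Cons x xs)
  then obtain a as' where as: "as = a # as'" by (cases as) auto
  with Cons show ?case by(auto simp: upd_Cons)
qed

text \<open>On \<open>xs\<close> the base assignment is overwritten, so \<open>e\<close> and
  \<open>e'\<close> may differ. This yields the equivariance in the parameter tuple needed for
  choice.\<close>

lemma upd_map:
  assumes "distinct xs" "length as = length xs" "v \<in> set xs"
  shows "upd e xs (map g as) v = g (upd e' xs as v)"
proof -
  have "map (upd e xs (map g as)) xs = map (g \<circ> upd e' xs as) xs"
    using assms by (simp add: map_upd_same flip: map_map)
  with assms(3) show ?thesis by (simp add: map_eq_conv)
qed

section \<open>Quantification over tuples of individuals\<close>

definition tuples :: "'a set \<Rightarrow> nat \<Rightarrow> 'a list set" where
  "tuples I n = {as. length as = n \<and> set as \<subseteq> I}"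

lemma length_tuples: "as \<in> tuples I n \<Longrightarrow> length as = n"
  by (simp add: tuples_def)

lemma ball_tuples_Suc:
  "(\<forall>as\<in>tuples I (Suc n). P as) \<longleftrightarrow> (\<forall>a\<in>I. \<forall>as\<in>tuples I n. P (a # as))"
proof
  assume *: "\<forall>a\<in>I. \<forall>as\<in>tuples I n. P (a # as)"
  show "\<forall>as\<in>tuples I (Suc n). P as"
  proof
    fix as assume "as \<in> tuples I (Suc n)"
    with * show "P as" by (cases as) (auto simp: tuples_def)
  qed
qed (auto simp: tuples_def)

lemma bex_tuples_Suc:
  "(\<exists>as\<in>tuples I (Suc n). P as) \<longleftrightarrow> (\<exists>a\<in>I. \<exists>as\<in>tuples I n. P (a # as))"
  using ball_tuples_Suc[of I n "\<lambda>as. \<not> P as"] by blast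

lemma satisfies_AllIs:
  "distinct xs \<Longrightarrow> satisfies \<Sigma> e f (AllIs xs H) \<longleftrightarrow>
    (\<forall>as\<in>tuples (indivs \<Sigma>) (length xs). satisfies \<Sigma> (upd e xs as) f H)"
proof (induction xs arbitrary: e)
  case Nil
  then show ?case by (auto simp: AllIs_def tuples_def)
next
  case (Cons x xs)
  have "AllIs (x # xs) H = AllI x (AllIs xs H)" by (simp add: AllIs_def)
  with Cons show ?case by (simp add: ball_tuples_Suc upd_Cons)
qed

lemma satisfies_ExIs:
  "distinct xs \<Longrightarrow> satisfies \<Sigma> e f (ExIs xs H) \<longleftrightarrow>
    (\<exists>as\<in>tuples (indivs \<Sigma>) (length xs). satisfies \<Sigma> (upd e xs as) f H)"
proof (induction xs arbitrary: e)
  case Nil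
  then show ?case by (auto simp: ExIs_def tuples_def)
next
  case (Cons x xs)
  have "ExIs (x # xs) H = ExI x (ExIs xs H)" by (simp add: ExIs_def)
  with Cons show ?case by (simp add: bex_tuples_Suc upd_Cons)
qed

lemma AllIs_append: "AllIs (xs @ ys) H = AllIs xs (AllIs ys H)"
  by (simp add: AllIs_def)

lemma satisfies_Conjs:
  "Hs \<noteq> [] \<Longrightarrow> satisfies \<Sigma> e f (Conjs Hs) \<longleftrightarrow> (\<forall>H\<in>set Hs. satisfies \<Sigma> e f H)"
proof (induction Hs)
  case (Cons H Hs)
  show ?case
  proof (cases "Hs = []")
    case True
    then show ?thesis by (simp add: Conjs_def)
  next
    case False
    then have "Conjs (H # Hs) = Conj H (Conjs Hs)" by (simp add: Conjs_def)
    with Cons False show ?thesis by simp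
  qed
qed simp

lemma satisfies_tuple_eq:
  assumes "xs \<noteq> []" "length ys = length xs"
  shows "satisfies \<Sigma> e f (tuple_eq xs ys) \<longleftrightarrow> map e xs = map e ys"
proof -
  have "map2 IEq xs ys \<noteq> []" using assms by (cases xs; cases ys) auto
  moreover have "(\<forall>H\<in>set (map2 IEq xs ys). satisfies \<Sigma> e f H) \<longleftrightarrow> map e xs = map e ys"
    using assms(2)[symmetric] by (induction xs ys rule: list_induct2) auto
  ultimately show ?thesis
    by (simp add: tuple_eq_def satisfies_Conjs del: set_map)
qed

section \<open>Semantic content of the injection and ordering formulas\<close>

lemma satisfies_inj_map_form:
  assumes n: "n \<ge> 1"
  shows "satisfies \<Sigma> e f (inj_map_form n F A B) \<longleftrightarrow>
    (\<forall>a\<in>tuples (indivs \<Sigma>) n. \<forall>b\<in>tuples (indivs \<Sigma>) n. f F (a @ b) \<longrightarrow> f A a \<and> f B b) \<and>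
    (\<forall>a\<in>tuples (indivs \<Sigma>) n. f A a \<longrightarrow> (\<exists>b\<in>tuples (indivs \<Sigma>) n. f F (a @ b))) \<and>
    (\<forall>a\<in>tuples (indivs \<Sigma>) n. \<forall>b\<in>tuples (indivs \<Sigma>) n. \<forall>c\<in>tuples (indivs \<Sigma>) n.
      f F (a @ b) \<and> f F (a @ c) \<longrightarrow> b = c) \<and>
    (\<forall>a\<in>tuples (indivs \<Sigma>) n. \<forall>b\<in>tuples (indivs \<Sigma>) n. \<forall>c\<in>tuples (indivs \<Sigma>) n.
      f F (a @ c) \<and> f F (b @ c) \<longrightarrow> a = b)"
proof -
  define x y z where xyz: "x = [0..<n]" "y = [n..<2*n]" "z = [2*n..<3*n]"
  \<comment> \<open>Disjointness of the blocks means that assigning one of them leaves the others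
    unchanged. Nonempty blocks, from \<open>n \<ge> 1\<close>, keep \<open>tuple_eq\<close> away
    from the unspecified value \<open>Conjs []\<close>.\<close>
  have d: "distinct x" "distinct y" "distinct z" "length x = n" "length y = n" "length z = n"
    "x \<noteq> []" "y \<noteq> []"
    "set x \<inter> set y = {}" "set y \<inter> set x = {}" "set x \<inter> set z = {}" "set z \<inter> set x = {}"
    "set y \<inter> set z = {}" "set z \<inter> set y = {}"
    using n by (auto simp: xyz)
  show ?thesis
    unfolding inj_map_form_def Let_def xyz[symmetric]
    by (simp add: satisfies_Conjs AllIs_append satisfies_AllIs satisfies_ExIs satisfies_tuple_eq
        map_upd_same length_tuples d cong: ball_cong_simp bex_cong_simp)
qed

lemma satisfies_linear_order_form:
  assumes n: "n \<ge> 1"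
  shows "satisfies \<Sigma> e f (linear_order_form n T A) \<longleftrightarrow>
    (\<forall>a\<in>tuples (indivs \<Sigma>) n. \<forall>b\<in>tuples (indivs \<Sigma>) n. f T (a @ b) \<longrightarrow> f A a \<and> f A b) \<and>
    (\<forall>a\<in>tuples (indivs \<Sigma>) n. f A a \<longrightarrow> f T (a @ a)) \<and>
    (\<forall>a\<in>tuples (indivs \<Sigma>) n. \<forall>b\<in>tuples (indivs \<Sigma>) n. \<forall>c\<in>tuples (indivs \<Sigma>) n.
      f T (a @ b) \<and> f T (b @ c) \<longrightarrow> f T (a @ c)) \<and>
    (\<forall>a\<in>tuples (indivs \<Sigma>) n. \<forall>b\<in>tuples (indivs \<Sigma>) n.
      f T (a @ b) \<and> f T (b @ a) \<longrightarrow> a = b) \<and>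
    (\<forall>a\<in>tuples (indivs \<Sigma>) n. \<forall>b\<in>tuples (indivs \<Sigma>) n.
      f A a \<and> f A b \<longrightarrow> f T (a @ b) \<or> f T (b @ a))"
proof -
  define x y z where xyz: "x = [0..<n]" "y = [n..<2*n]" "z = [2*n..<3*n]"
  have d: "distinct x" "distinct y" "distinct z" "length x = n" "length y = n" "length z = n"
    "x \<noteq> []" "y \<noteq> []"
    "set x \<inter> set y = {}" "set y \<inter> set x = {}" "set x \<inter> set z = {}" "set z \<inter> set x = {}"
    "set y \<inter> set z = {}" "set z \<inter> set y = {}"
    using n by (auto simp: xyz)
  show ?thesis
    unfolding linear_order_form_def Let_def xyz[symmetric]
    by (simp add: satisfies_Conjs AllIs_append satisfies_AllIs satisfies_tuple_eq
        map_upd_same length_tuples d cong: ball_cong_simp bex_cong_simp)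
qed

text \<open>Coincidence lemma, with all occurring variables in place of the free ones. This form
  suffices because the proviso on \<open>S\<close> in \<open>choice_h\<close> also speaks of all
  occurrences.\<close>

lemma satisfies_cong:
  "(\<And>x. x \<in> ivars H \<Longrightarrow> e x = e' x) \<Longrightarrow> (\<And>Q. Q \<in> pvars H \<Longrightarrow> f Q = f' Q) \<Longrightarrow>
    satisfies \<Sigma> e f H \<longleftrightarrow> satisfies \<Sigma> e' f' H"
proof (induction H arbitrary: e e' f f')
  case (Atom P xs)
  then show ?case by (simp cong: map_cong)
next
  case (AllI x H)
  then have "satisfies \<Sigma> (e(x := a)) f H \<longleftrightarrow> satisfies \<Sigma> (e'(x := a)) f' H" for a
    by (intro AllI.IH) auto
  then show ?case by simp
next
  case (ExI x H)
  then have "satisfies \<Sigma> (e(x := a)) f H \<longleftrightarrow> satisfies \<Sigma> (e'(x := a)) f' H" for a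
    by (intro ExI.IH) auto
  then show ?case by simp
next
  case (AllP P H)
  then have "satisfies \<Sigma> e (f(P := \<alpha>)) H \<longleftrightarrow> satisfies \<Sigma> e' (f'(P := \<alpha>)) H" for \<alpha>
    by (intro AllP.IH) auto
  then show ?case by simp
next
  case (ExP P H)
  then have "satisfies \<Sigma> e (f(P := \<alpha>)) H \<longleftrightarrow> satisfies \<Sigma> e' (f'(P := \<alpha>)) H" for \<alpha>
    by (intro ExP.IH) auto
  then show ?case by simp
next
  case (Neg H)
  then show ?case by (metis ivars.simps(4) pvars.simps(4) satisfies.simps(4))
next
  case (Conj G H)
  have "satisfies \<Sigma> e f G \<longleftrightarrow> satisfies \<Sigma> e' f' G" "satisfies \<Sigma> e f H \<longleftrightarrow> satisfies \<Sigma> e' f' H"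
    by (intro Conj; simp)+
  then show ?case by simp
next
  case (Disj G H)
  have "satisfies \<Sigma> e f G \<longleftrightarrow> satisfies \<Sigma> e' f' G" "satisfies \<Sigma> e f H \<longleftrightarrow> satisfies \<Sigma> e' f' H"
    by (intro Disj; simp)+
  then show ?case by simp
next
  case (Imp G H)
  have "satisfies \<Sigma> e f G \<longleftrightarrow> satisfies \<Sigma> e' f' G" "satisfies \<Sigma> e f H \<longleftrightarrow> satisfies \<Sigma> e' f' H"
    by (intro Imp; simp)+
  then show ?case by simp
next
  case (Iff G H)
  have "satisfies \<Sigma> e f G \<longleftrightarrow> satisfies \<Sigma> e' f' G" "satisfies \<Sigma> e f H \<longleftrightarrow> satisfies \<Sigma> e' f' H"
    by (intro Iff; simp)+
  then show ?case by simp
qed simp_all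

lemma finite_ivars: "finite (ivars H)"
  by (induction H) auto

lemma finite_pvars: "finite (pvars H)"
  by (induction H) auto

lemma wf_form_arity: "wf_form H \<Longrightarrow> Q \<in> pvars H \<Longrightarrow> arity Q \<ge> 1"
  by (induction H) auto

section \<open>Group action and supports\<close>

lemma pred_act_map: "inj \<pi> \<Longrightarrow> pred_act \<pi> \<alpha> (map \<pi> xs) \<longleftrightarrow> \<alpha> xs"
  by (simp add: pred_act_def comp_def)

lemma pred_act_comp:
  "bij \<pi> \<Longrightarrow> bij \<sigma> \<Longrightarrow> pred_act (\<pi> \<circ> \<sigma>) \<alpha> = pred_act \<pi> (pred_act \<sigma> \<alpha>)"
  by (simp add: pred_act_def o_inv_distrib)

lemma pred_act_id [simp]: "pred_act id \<alpha> = \<alpha>"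
  by (simp add: pred_act_def)

text \<open>Turns the condition on images of the two sorts into a pointwise one. It may range over
  all \<open>p\<close>, since a permutation of \<open>I2\<close> is the identity elsewhere.\<close>

lemma G2_iff: "\<pi> \<in> G2 \<longleftrightarrow> \<pi> permutes I2 \<and> (\<forall>p. fst (\<pi> p) = fst p)"
proof
  assume \<pi>: "\<pi> \<in> G2"
  have "fst (\<pi> p) = fst p" for p
  proof (cases "p \<in> I2")
    case True
    then have "fst p = 0 \<or> fst p = 1" by (auto simp: I2_def)
    then have "\<pi> ` ({fst p} \<times> UNIV) = {fst p} \<times> UNIV"
      using \<pi> unfolding G2_def by (elim disjE) simp_all
    moreover have "\<pi> p \<in> \<pi> ` ({fst p} \<times> UNIV)"
      by (intro imageI) (simp add: mem_Times_iff)
    ultimately show ?thesis by (simp add: mem_Times_iff)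
  next
    case False
    moreover have "\<pi> permutes I2" using \<pi> by (simp add: G2_def)
    ultimately show ?thesis by (metis permutes_not_in)
  qed
  with \<pi> show "\<pi> permutes I2 \<and> (\<forall>p. fst (\<pi> p) = fst p)" by (simp add: G2_def)
next
  assume \<pi>: "\<pi> permutes I2 \<and> (\<forall>p. fst (\<pi> p) = fst p)"
  then have "surj \<pi>" by (auto dest: permutes_surj)
  have "\<pi> ` ({j} \<times> UNIV) = {j} \<times> UNIV" for j
  proof
    show "\<pi> ` ({j} \<times> UNIV) \<subseteq> {j} \<times> UNIV" using \<pi> by (intro image_subsetI) (simp add: mem_Times_iff del: split_paired_All)
    show "{j} \<times> UNIV \<subseteq> \<pi> ` ({j} \<times> UNIV)"
    proof
      fix q assume q: "q \<in> {j} \<times> (UNIV :: nat set)"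
      obtain p where p: "q = \<pi> p" using \<open>surj \<pi>\<close> by (meson surjD)
      with q have "fst (\<pi> p) = j" by (auto simp: mem_Times_iff)
      with \<pi> have "fst p = j" by metis
      with p show "q \<in> \<pi> ` ({j} \<times> UNIV)" by (auto simp: mem_Times_iff)
    qed
  qed
  with \<pi> show "\<pi> \<in> G2" by (simp add: G2_def)
qed

lemma G2_bij: "\<pi> \<in> G2 \<Longrightarrow> bij \<pi>"
  by (auto simp: G2_iff dest: permutes_bij)

lemma G2_inj: "\<pi> \<in> G2 \<Longrightarrow> inj \<pi>"
  by (simp add: G2_bij bij_is_inj)

lemma G2_inv_eq [simp]: "\<pi> \<in> G2 \<Longrightarrow> \<pi> (inv \<pi> p) = p" "\<pi> \<in> G2 \<Longrightarrow> inv \<pi> (\<pi> p) = p"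
  by (auto dest!: G2_bij simp: bij_is_surj bij_is_inj surj_f_inv_f)

lemma G2_comp: "\<pi> \<in> G2 \<Longrightarrow> \<sigma> \<in> G2 \<Longrightarrow> \<pi> \<circ> \<sigma> \<in> G2"
  by (simp add: G2_iff permutes_compose del: split_paired_All)

lemma G2_inv: "\<pi> \<in> G2 \<Longrightarrow> inv \<pi> \<in> G2"
  using G2_inv_eq(1) by (metis G2_iff permutes_inv)

lemma G2_in_I2: "\<pi> \<in> G2 \<Longrightarrow> \<pi> p \<in> I2 \<longleftrightarrow> p \<in> I2"
  by (simp add: G2_iff permutes_in_image)

lemma G2_transpose:
  assumes "a \<in> I2" "b \<in> I2" "fst a = fst b"
  shows "transpose a b \<in> G2"
proof -
  have "fst (transpose a b p) = fst p" for p
    unfolding transpose_def using assms(3) by metis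
  with assms show ?thesis by (simp add: G2_iff permutes_swap_id)
qed

section \<open>Pointwise stabilizers and finite supports\<close>

definition stab :: "(nat \<times> nat) set \<Rightarrow> (nat \<times> nat \<Rightarrow> nat \<times> nat) set" where
  "stab E = {\<pi> \<in> G2. \<forall>p\<in>E. \<pi> p = p}"

lemma stab_G2: "\<pi> \<in> stab E \<Longrightarrow> \<pi> \<in> G2"
  by (simp add: stab_def)

lemma stab_id: "id \<in> stab E"
  by (simp add: stab_def G2_iff permutes_id)

lemma stab_comp: "\<pi> \<in> stab E \<Longrightarrow> \<sigma> \<in> stab E \<Longrightarrow> \<pi> \<circ> \<sigma> \<in> stab E"
  by (simp add: stab_def G2_comp)

lemma stab_inv:
  assumes "\<pi> \<in> stab E"
  shows "inv \<pi> \<in> stab E"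
proof -
  have "inv \<pi> p = p" if "p \<in> E" for p
    using assms that G2_inv_eq(2)[of \<pi> p] unfolding stab_def by (metis (mono_tags, lifting) mem_Collect_eq)
  with assms show ?thesis by (simp add: stab_def G2_inv)
qed

lemma stab_mono: "P \<subseteq> E \<Longrightarrow> stab E \<subseteq> stab P"
  by (auto simp: stab_def)

text \<open>The source of every exchange argument: apart from the identity, the only concrete group
  elements constructed below are such transpositions.\<close>

lemma stab_transpose:
  "a \<in> I2 \<Longrightarrow> b \<in> I2 \<Longrightarrow> fst a = fst b \<Longrightarrow> a \<notin> E \<Longrightarrow> b \<notin> E \<Longrightarrow> transpose a b \<in> stab E"
  by (auto simp: stab_def G2_transpose transpose_def)



definition supports :: "(nat \<times> nat) set \<Rightarrow> ((nat \<times> nat) list \<Rightarrow> bool) \<Rightarrow> bool" where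
  "supports Q \<alpha> \<longleftrightarrow> (\<forall>\<pi>\<in>stab Q. pred_act \<pi> \<alpha> = \<alpha>)"

lemma indivs_two_Sigma_0 [simp]: "indivs two_Sigma_0 = I2"
  by (simp add: two_Sigma_0_def)

lemma preds_two_Sigma_0:
  "preds two_Sigma_0 n = {\<alpha> \<in> nary_preds I2 n. \<exists>Q. finite Q \<and> Q \<subseteq> I2 \<and> supports Q \<alpha>}"
  by (auto simp: two_Sigma_0_def supports_def stab_def)

lemma supports_mono: "supports Q \<alpha> \<Longrightarrow> Q \<subseteq> E \<Longrightarrow> supports E \<alpha>"
  unfolding supports_def using stab_mono by blast

text \<open>Conjugation by \<open>\<pi>\<close> turns a permutation fixing the image of
  \<open>Q\<close> into one fixing \<open>Q\<close>, so supports are carried along with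
  predicates.\<close>

lemma supports_pred_act:
  assumes "supports Q \<alpha>" and \<pi>: "\<pi> \<in> G2"
  shows "supports (\<pi> ` Q) (pred_act \<pi> \<alpha>)"
  unfolding supports_def
proof
  fix \<sigma> assume \<sigma>: "\<sigma> \<in> stab (\<pi> ` Q)"
  define \<tau> where "\<tau> = inv \<pi> \<circ> \<sigma> \<circ> \<pi>"
  have "\<tau> \<in> stab Q"
    using \<pi> \<sigma> by (auto simp: \<tau>_def stab_def intro!: G2_comp G2_inv)
  moreover have "\<sigma> \<circ> \<pi> = \<pi> \<circ> \<tau>"
    using \<pi> by (auto simp: \<tau>_def fun_eq_iff)
  ultimately show "pred_act \<sigma> (pred_act \<pi> \<alpha>) = pred_act \<pi> \<alpha>"
    using assms \<sigma> by (metis G2_bij pred_act_comp stab_G2 supports_def)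
qed

lemma pred_act_inv:
  assumes "\<pi> \<in> G2"
  shows "pred_act \<pi> (pred_act (inv \<pi>) \<alpha>) = \<alpha>" "pred_act (inv \<pi>) (pred_act \<pi> \<alpha>) = \<alpha>"
proof -
  have "\<pi> \<circ> inv \<pi> = id" "inv \<pi> \<circ> \<pi> = id"
    using assms by (auto simp: fun_eq_iff)
  then show "pred_act \<pi> (pred_act (inv \<pi>) \<alpha>) = \<alpha>" "pred_act (inv \<pi>) (pred_act \<pi> \<alpha>) = \<alpha>"
    using assms by (metis G2_bij G2_inv pred_act_comp pred_act_id)+
qed

lemma pred_act_nary_preds:
  assumes "\<pi> \<in> G2" "\<alpha> \<in> nary_preds I2 n"
  shows "pred_act \<pi> \<alpha> \<in> nary_preds I2 n"
  unfolding nary_preds_def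
proof (intro CollectI allI impI)
  fix xs assume "pred_act \<pi> \<alpha> xs"
  then have "length (map (inv \<pi>) xs) = n" "set (map (inv \<pi>) xs) \<subseteq> I2"
    using assms(2) unfolding nary_preds_def pred_act_def by blast+
  with assms(1) show "length xs = n \<and> set xs \<subseteq> I2"
    using G2_in_I2[OF G2_inv[OF assms(1)]] by auto
qed

lemma pred_act_preds:
  assumes "\<pi> \<in> G2" "\<alpha> \<in> preds two_Sigma_0 n"
  shows "pred_act \<pi> \<alpha> \<in> preds two_Sigma_0 n"
proof -
  obtain Q where Q: "finite Q" "Q \<subseteq> I2" "supports Q \<alpha>" and "\<alpha> \<in> nary_preds I2 n"
    using assms(2) by (auto simp: preds_two_Sigma_0)
  moreover have "finite (\<pi> ` Q)" "\<pi> ` Q \<subseteq> I2" "supports (\<pi> ` Q) (pred_act \<pi> \<alpha>)"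
    using Q assms(1) by (auto simp: G2_in_I2 supports_pred_act)
  ultimately show ?thesis
    using assms(1) by (auto simp: preds_two_Sigma_0 pred_act_nary_preds)
qed

lemma map_tuples: "\<pi> \<in> G2 \<Longrightarrow> xs \<in> tuples I2 n \<Longrightarrow> map \<pi> xs \<in> tuples I2 n"
  by (auto simp: tuples_def G2_in_I2)

text \<open>The group acts by automorphisms: \<open>\<pi>\<close> maps \<open>I2\<close> and each
  domain of predicates onto itself, so under a quantifier the bound value may be replaced by its
  translate, and the induction hypothesis applies to the updated assignment. Equality atoms survive
  because the action is invertible.\<close>

lemma satisfies_pred_act:
  assumes \<pi>: "\<pi> \<in> G2"
  shows "satisfies two_Sigma_0 (\<pi> \<circ> e) (\<lambda>Q. pred_act \<pi> (f Q)) H \<longleftrightarrow> satisfies two_Sigma_0 e f H"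
proof (induction H arbitrary: e f)
  case (Atom P xs)
  show ?case using pred_act_map[OF G2_inj[OF \<pi>], of "f P" "map e xs"] by (simp add: comp_def)
next
  case (IEq x y)
  show ?case using G2_inj[OF \<pi>] by (simp add: inj_eq)
next
  case (PEq P Q)
  show ?case using pred_act_inv[OF \<pi>] by (metis satisfies.simps(3))
next
  case (AllI x H)
  have "(\<forall>a\<in>I2. satisfies two_Sigma_0 ((\<pi> \<circ> e)(x := a)) (\<lambda>Q. pred_act \<pi> (f Q)) H) \<longleftrightarrow>
    (\<forall>a\<in>I2. satisfies two_Sigma_0 ((\<pi> \<circ> e)(x := \<pi> a)) (\<lambda>Q. pred_act \<pi> (f Q)) H)"
    using \<pi> by (metis G2_in_I2 G2_inv_eq(1))
  also have "\<dots> \<longleftrightarrow> (\<forall>a\<in>I2. satisfies two_Sigma_0 (\<pi> \<circ> e(x := a)) (\<lambda>Q. pred_act \<pi> (f Q)) H)"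
    by (simp only: fun_upd_comp)
  finally show ?case unfolding satisfies.simps indivs_two_Sigma_0 AllI.IH .
next
  case (ExI x H)
  have "(\<exists>a\<in>I2. satisfies two_Sigma_0 ((\<pi> \<circ> e)(x := a)) (\<lambda>Q. pred_act \<pi> (f Q)) H) \<longleftrightarrow>
    (\<exists>a\<in>I2. satisfies two_Sigma_0 ((\<pi> \<circ> e)(x := \<pi> a)) (\<lambda>Q. pred_act \<pi> (f Q)) H)"
    using \<pi> by (metis G2_in_I2 G2_inv_eq(1))
  also have "\<dots> \<longleftrightarrow> (\<exists>a\<in>I2. satisfies two_Sigma_0 (\<pi> \<circ> e(x := a)) (\<lambda>Q. pred_act \<pi> (f Q)) H)"
    by (simp only: fun_upd_comp)
  finally show ?case unfolding satisfies.simps indivs_two_Sigma_0 ExI.IH .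
next
  case (AllP P H)
  have upd: "(\<lambda>Q. pred_act \<pi> (f Q))(P := pred_act \<pi> \<alpha>) = (\<lambda>Q. pred_act \<pi> ((f(P := \<alpha>)) Q))" for \<alpha>
    by auto
  have "(\<forall>\<alpha>\<in>preds two_Sigma_0 (arity P).
      satisfies two_Sigma_0 (\<pi> \<circ> e) ((\<lambda>Q. pred_act \<pi> (f Q))(P := \<alpha>)) H) \<longleftrightarrow>
    (\<forall>\<alpha>\<in>preds two_Sigma_0 (arity P).
      satisfies two_Sigma_0 (\<pi> \<circ> e) ((\<lambda>Q. pred_act \<pi> (f Q))(P := pred_act \<pi> \<alpha>)) H)"
    using \<pi> by (metis pred_act_preds pred_act_inv(1) G2_inv)
  then show ?case by (simp only: upd AllP.IH satisfies.simps)
next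
  case (ExP P H)
  have upd: "(\<lambda>Q. pred_act \<pi> (f Q))(P := pred_act \<pi> \<alpha>) = (\<lambda>Q. pred_act \<pi> ((f(P := \<alpha>)) Q))" for \<alpha>
    by auto
  have "(\<exists>\<alpha>\<in>preds two_Sigma_0 (arity P).
      satisfies two_Sigma_0 (\<pi> \<circ> e) ((\<lambda>Q. pred_act \<pi> (f Q))(P := \<alpha>)) H) \<longleftrightarrow>
    (\<exists>\<alpha>\<in>preds two_Sigma_0 (arity P).
      satisfies two_Sigma_0 (\<pi> \<circ> e) ((\<lambda>Q. pred_act \<pi> (f Q))(P := pred_act \<pi> \<alpha>)) H)"
    using \<pi> by (metis pred_act_preds pred_act_inv(1) G2_inv)
  then show ?case by (simp only: upd ExP.IH satisfies.simps)
qed simp_all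

definition pool :: "nat \<Rightarrow> (nat \<times> nat) set" where
  "pool k = {0, 1} \<times> {..k}"

lemma finite_pool: "finite (pool k)"
  by (simp add: pool_def)

lemma pool_I2: "pool k \<subseteq> I2"
  by (auto simp: pool_def I2_def)

text \<open>The pool meets the sort of \<open>p\<close> in \<open>k + 1\<close> elements, one more
  than \<open>F\<close> can cover. It depends only on the bound \<open>k\<close>, so one finite set
  serves all \<open>F\<close> of bounded size.\<close>

lemma fresh_in_pool:
  assumes "p \<in> I2" "finite F" "card F \<le> k"
  obtains r where "r \<in> pool k" "r \<in> I2" "fst r = fst p" "r \<notin> F"
proof -
  have "card ({fst p} \<times> {..k}) = Suc k"
    by (simp add: card_cartesian_product)
  then have "\<not> {fst p} \<times> {..k} \<subseteq> F"
    using assms card_mono[of F "{fst p} \<times> {..k}"] by fastforce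
  then obtain r where "r \<in> {fst p} \<times> {..k}" "r \<notin> F" by blast
  with assms(1) that show ?thesis by (auto simp: pool_def I2_def)
qed

section \<open>Trichotomy and linear ordering\<close>

text \<open>The diagonal copy of \<open>X\<close> among the \<open>n\<close>-tuples, which transfers
  counterexamples from individuals to every arity \<open>n \<ge> 1\<close>.\<close>

definition const_tuples :: "nat \<Rightarrow> (nat \<times> nat) set \<Rightarrow> (nat \<times> nat) list \<Rightarrow> bool" where
  "const_tuples n X xs \<longleftrightarrow> (\<exists>a\<in>X. xs = replicate n a)"

lemma const_tuples_replicate:
  assumes "n \<ge> 1"
  shows "const_tuples n X (replicate n a) \<longleftrightarrow> a \<in> X"
  using assms by (auto simp: const_tuples_def replicate_eq_replicate)

text \<open>Invariance of \<open>X\<close> under the whole group makes the predicate invariant too,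
  so the empty set is a support.\<close>

lemma const_tuples_preds:
  assumes "X \<subseteq> I2" and X: "\<And>\<pi>. \<pi> \<in> G2 \<Longrightarrow> \<pi> ` X \<subseteq> X"
  shows "const_tuples n X \<in> preds two_Sigma_0 n"
proof -
  have *: "const_tuples n X (map \<pi> xs)" if \<pi>: "\<pi> \<in> G2" and xs: "const_tuples n X xs" for \<pi> xs
  proof -
    obtain a where "a \<in> X" "xs = replicate n a" using xs by (auto simp: const_tuples_def)
    then show ?thesis using X[OF \<pi>] by (auto simp: const_tuples_def intro!: bexI[of _ "\<pi> a"])
  qed
  have "pred_act \<pi> (const_tuples n X) = const_tuples n X" if \<pi>: "\<pi> \<in> G2" for \<pi>
  proof
    fix xs
    have "map \<pi> (map (inv \<pi>) xs) = xs" using \<pi> by (simp add: comp_def)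
    then show "pred_act \<pi> (const_tuples n X) xs = const_tuples n X xs"
      unfolding pred_act_def using \<pi> * G2_inv by metis
  qed
  moreover have "const_tuples n X \<in> nary_preds I2 n"
    using assms(1) by (auto simp: const_tuples_def nary_preds_def)
  ultimately show ?thesis
    by (auto simp: preds_two_Sigma_0 supports_def stab_def intro!: exI[of _ "{}"])
qed

lemma sort_subset_I2: "j \<in> {0, 1} \<Longrightarrow> {j} \<times> UNIV \<subseteq> I2"
  by (auto simp: I2_def)

lemma sort_preds:
  assumes "j \<in> {0, 1}"
  shows "const_tuples n ({j} \<times> UNIV) \<in> preds two_Sigma_0 n"
proof (rule const_tuples_preds[OF sort_subset_I2[OF assms]])
  fix \<pi> assume "\<pi> \<in> G2"
  then have "fst (\<pi> p) = fst p" for p by (simp add: G2_iff del: split_paired_All)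
  then show "\<pi> ` ({j} \<times> UNIV) \<subseteq> {j} \<times> UNIV"
    by (intro image_subsetI) (simp add: mem_Times_iff)
qed

lemma fresh_pair:
  assumes "j \<in> {0, 1}" "finite F"
  obtains a a' where "a \<in> {j} \<times> UNIV" "a' \<in> {j} \<times> UNIV" "a \<notin> F" "a' \<notin> F" "a \<noteq> (a' :: nat \<times> nat)"
proof -
  have j: "(j, 0) \<in> I2" using assms(1) by (auto simp: I2_def)
  obtain a where a: "fst a = j" "a \<notin> F"
    using fresh_in_pool[OF j assms(2) order_refl] by (metis fst_conv)
  obtain a' where a': "fst a' = j" "a' \<notin> insert a F"
    using fresh_in_pool[OF j, of "insert a F"] assms(2) by (metis finite_insert fst_conv order_refl)
  show ?thesis using that[of a a'] a a' by (auto simp: mem_Times_iff)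
qed

text \<open>Let \<open>F\<close> send the constant tuple of some \<open>a\<close> outside the
  support \<open>Q\<close> to that of \<open>b\<close>. If \<open>b\<close> lies in
  \<open>Q\<close>, moving \<open>a\<close> contradicts injectivity; otherwise moving
  \<open>b\<close> contradicts single-valuedness. Since the sorts differ, each move leaves the other
  side alone.\<close>

lemma no_injection:
  assumes n: "n \<ge> 1" and F: "F \<in> preds two_Sigma_0 (2 * n)"
    and ij: "i \<in> {0, 1}" "j \<in> {0, 1}" "i \<noteq> j"
    and A: "f A = const_tuples n ({i} \<times> UNIV)" and B: "f B = const_tuples n ({j} \<times> UNIV)"
    and f: "f P = F"
  shows "\<not> satisfies two_Sigma_0 e f (inj_map_form n P A B)"
proof
  assume sat: "satisfies two_Sigma_0 e f (inj_map_form n P A B)"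
  have maps: "\<And>a b. a \<in> tuples I2 n \<Longrightarrow> b \<in> tuples I2 n \<Longrightarrow> F (a @ b) \<Longrightarrow> f B b"
    and total: "\<And>a. a \<in> tuples I2 n \<Longrightarrow> f A a \<Longrightarrow> \<exists>b\<in>tuples I2 n. F (a @ b)"
    and sv: "\<And>a b c. a \<in> tuples I2 n \<Longrightarrow> b \<in> tuples I2 n \<Longrightarrow> c \<in> tuples I2 n \<Longrightarrow>
      F (a @ b) \<Longrightarrow> F (a @ c) \<Longrightarrow> b = c"
    and inj: "\<And>a b c. a \<in> tuples I2 n \<Longrightarrow> b \<in> tuples I2 n \<Longrightarrow> c \<in> tuples I2 n \<Longrightarrow>
      F (a @ c) \<Longrightarrow> F (b @ c) \<Longrightarrow> a = b"
    using sat unfolding satisfies_inj_map_form[OF n] f indivs_two_Sigma_0 by blast+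
  obtain Q where Q: "finite Q" "Q \<subseteq> I2" "supports Q F"
    using F by (auto simp: preds_two_Sigma_0)
  obtain a a' where a: "a \<in> {i} \<times> UNIV" "a' \<in> {i} \<times> UNIV" "a \<notin> Q" "a' \<notin> Q" "a \<noteq> a'"
    using fresh_pair[OF ij(1) Q(1)] .
  have rep: "replicate n p \<in> tuples I2 n" if "p \<in> {i, j} \<times> UNIV" for p
    using that ij by (auto simp: tuples_def I2_def)
  \<comment> \<open>A transposition within one sort and off \<open>Q\<close> fixes \<open>F\<close>,
    so it may be applied to argument and value simultaneously.\<close>
  have swap: "F (replicate n (transpose p q c) @ replicate n (transpose p q d))"
    if "p \<in> {k} \<times> UNIV" "q \<in> {k} \<times> UNIV" "k \<in> {0, 1}" "p \<notin> Q" "q \<notin> Q"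
      "F (replicate n c @ replicate n d)" for p q c d k
  proof -
    have "transpose p q \<in> stab Q"
      using that by (intro stab_transpose) (auto simp: I2_def)
    then have "pred_act (transpose p q) F = F" "inj (transpose p q)"
      using Q(3) by (auto simp: supports_def)
    with that(6) show ?thesis
      using pred_act_map[of "transpose p q" F "replicate n c @ replicate n d"] by simp
  qed
  obtain bs where bs: "bs \<in> tuples I2 n" "F (replicate n a @ bs)"
    using total[OF rep[of a]] a n by (auto simp: A const_tuples_replicate)
  then have "f B bs" using a by (intro maps[OF rep[of a]]) auto
  then obtain b where b: "b \<in> {j} \<times> UNIV" "F (replicate n a @ replicate n b)"
    using bs(2) unfolding B const_tuples_def by blast
  show False
  proof (cases "b \<in> Q")
    case True
    have "transpose a a' b = b"
      using a b ij by (intro transpose_apply_other) auto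
    with swap[OF a(1,2) ij(1) a(3,4) b(2)] have "F (replicate n a' @ replicate n b)" by simp
    with inj[OF rep rep rep b(2), of a'] a b(1) n show False
      by (auto simp: replicate_eq_replicate)
  next
    case False
    \<comment> \<open>Avoiding \<open>insert b Q\<close> rather than \<open>Q\<close> forces
      \<open>b'\<close> to differ from \<open>b\<close>.\<close>
    obtain b' b'' where b': "b' \<in> {j} \<times> UNIV" "b'' \<in> {j} \<times> UNIV" "b' \<notin> insert b Q"
      "b'' \<notin> insert b Q" "b' \<noteq> b''"
      using fresh_pair[OF ij(2) finite.insertI[OF Q(1)]] .
    have "transpose b b' a = a"
      using a b b' ij by (intro transpose_apply_other) auto
    with swap[OF b(1) b'(1) ij(2) False _ b(2)] b'(3)
    have "F (replicate n a @ replicate n b')" by simp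
    with sv[OF rep rep rep b(2), of b'] a b(1) b' n show False
      by (auto simp: replicate_eq_replicate)
  qed
qed

lemma two_Sigma_0_not_TR:
  assumes n: "n \<ge> 1"
  shows "models two_Sigma_0 (Neg (TR n))"
  unfolding models_def
proof (intro allI impI)
  fix e f
  define A B F where "A = PVar n 0" "B = PVar n 1" "F = PVar (2 * n) 0"
  let ?\<alpha> = "const_tuples n ({0} \<times> UNIV)" and ?\<beta> = "const_tuples n ({1} \<times> UNIV)"
  have neq: "A \<noteq> B" "A \<noteq> F" "B \<noteq> F" and ar: "arity A = n" "arity B = n" "arity F = 2 * n"
    using n by (auto simp: A_B_F_def)
  have preds: "?\<alpha> \<in> preds two_Sigma_0 n" "?\<beta> \<in> preds two_Sigma_0 n"
    by (simp_all add: sort_preds)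
  have "\<not> satisfies two_Sigma_0 e (f(A := ?\<alpha>, B := ?\<beta>, F := \<phi>)) (inj_map_form n F A B)"
    "\<not> satisfies two_Sigma_0 e (f(A := ?\<alpha>, B := ?\<beta>, F := \<phi>)) (inj_map_form n F B A)"
    if "\<phi> \<in> preds two_Sigma_0 (2 * n)" for \<phi>
    by (rule no_injection[OF n that, of 0 1]; use neq in simp)
      (rule no_injection[OF n that, of 1 0]; use neq in simp)
  with preds ar show "satisfies two_Sigma_0 e f (Neg (TR n))"
    unfolding TR_def Let_def A_B_F_def[symmetric] by (simp del: One_nat_def) blast
qed

text \<open>A transposition of \<open>a\<close> and \<open>a'\<close> off the support reverses the
  pair of their constant tuples. Totality then gives both comparisons, against antisymmetry.\<close>

lemma two_Sigma_0_not_LO: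
  assumes n: "n \<ge> 1"
  shows "models two_Sigma_0 (Neg (LO n))"
  unfolding models_def
proof (intro allI impI)
  fix e :: "ivar \<Rightarrow> nat \<times> nat" and f
  define A T where "A = PVar n 0" "T = PVar (2 * n) 0"
  let ?\<alpha> = "const_tuples n ({0} \<times> UNIV)"
  have neq: "A \<noteq> T" and ar: "arity A = n" "arity T = 2 * n"
    using n by (auto simp: A_T_def)
  have preds: "?\<alpha> \<in> preds two_Sigma_0 n"
    by (simp add: sort_preds)
  have "\<not> satisfies two_Sigma_0 e (f(A := ?\<alpha>, T := \<tau>)) (linear_order_form n T A)"
    if \<tau>: "\<tau> \<in> preds two_Sigma_0 (2 * n)" for \<tau>
  proof
    assume sat: "satisfies two_Sigma_0 e (f(A := ?\<alpha>, T := \<tau>)) (linear_order_form n T A)"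
    have val: "(f(A := ?\<alpha>, T := \<tau>)) T = \<tau>" "(f(A := ?\<alpha>, T := \<tau>)) A = ?\<alpha>"
      using neq by simp_all
    have antisym: "\<And>a b. a \<in> tuples I2 n \<Longrightarrow> b \<in> tuples I2 n \<Longrightarrow> \<tau> (a @ b) \<Longrightarrow> \<tau> (b @ a) \<Longrightarrow> a = b"
      and total: "\<And>a b. a \<in> tuples I2 n \<Longrightarrow> b \<in> tuples I2 n \<Longrightarrow> ?\<alpha> a \<Longrightarrow> ?\<alpha> b \<Longrightarrow>
        \<tau> (a @ b) \<or> \<tau> (b @ a)"
      using sat unfolding satisfies_linear_order_form[OF n] val indivs_two_Sigma_0 by blast+
    obtain Q where Q: "finite Q" "Q \<subseteq> I2" "supports Q \<tau>"
      using \<tau> by (auto simp: preds_two_Sigma_0)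
    obtain a a' where a: "a \<in> {0} \<times> UNIV" "a' \<in> {0} \<times> UNIV" "a \<notin> Q" "a' \<notin> Q" "a \<noteq> a'"
      using fresh_pair[OF insertI1 Q(1)] .
    have "transpose a a' \<in> stab Q"
      using a by (intro stab_transpose) (auto simp: I2_def)
    then have act: "pred_act (transpose a a') \<tau> = \<tau>"
      using Q(3) by (auto simp: supports_def)
    have "\<tau> (replicate n a @ replicate n a') \<longleftrightarrow> \<tau> (replicate n a' @ replicate n a)"
      using pred_act_map[of "transpose a a'" \<tau> "replicate n a @ replicate n a'"]
      unfolding act by simp
    moreover have "replicate n a \<in> tuples I2 n" "replicate n a' \<in> tuples I2 n"
      using a by (auto simp: tuples_def I2_def)
    moreover have "?\<alpha> (replicate n a)" "?\<alpha> (replicate n a')"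
      using a by (simp_all add: const_tuples_replicate[OF n])
    ultimately have "replicate n a = replicate n a'"
      using antisym total by blast
    with a(5) n show False by (auto simp: replicate_eq_replicate)
  qed
  with preds ar show "satisfies two_Sigma_0 e f (Neg (LO n))"
    unfolding LO_def Let_def A_T_def[symmetric] by auto
qed


section \<open>Choice\<close>

text \<open>\<open>\<Phi> xs \<delta>\<close> abstracts "\<open>\<delta>\<close> is a solution at
  \<open>xs\<close>". Transpositions fixing \<open>P\<close> bring every tuple into a finite set
  \<open>N\<close>, and translating a solution does not enlarge its support, so the finitely many
  tuples over \<open>N\<close> determine a common bound.\<close>

lemma bounded_supports:
  assumes P: "finite P" "P \<subseteq> I2"
    and inv: "\<And>\<pi> xs \<delta>. \<pi> \<in> stab P \<Longrightarrow> \<Phi> xs \<delta> \<Longrightarrow> \<Phi> (map \<pi> xs) (pred_act \<pi> \<delta>)"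
    and ex: "\<And>xs. xs \<in> tuples I2 n \<Longrightarrow> \<exists>\<delta>\<in>preds two_Sigma_0 m. \<Phi> xs \<delta>"
  obtains k where "\<forall>xs\<in>tuples I2 n.
    \<exists>\<delta>\<in>preds two_Sigma_0 m. \<Phi> xs \<delta> \<and> (\<exists>Q. finite Q \<and> Q \<subseteq> I2 \<and> card Q \<le> k \<and> supports Q \<delta>)"
proof -
  define B where "B xs k \<longleftrightarrow> (\<exists>\<delta>\<in>preds two_Sigma_0 m. \<Phi> xs \<delta> \<and>
    (\<exists>Q. finite Q \<and> Q \<subseteq> I2 \<and> card Q \<le> k \<and> supports Q \<delta>))" for xs k
  \<comment> \<open>A replacement entry must avoid \<open>P\<close> and the entries of the tuple, at
    most \<open>card P + n\<close> individuals.\<close>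
  define N where "N = P \<union> pool (card P + n)"
  have "\<exists>k. B xs k" if "xs \<in> tuples I2 n" for xs
    using ex[OF that] unfolding B_def preds_two_Sigma_0 by blast
  then obtain b where b: "\<And>xs. xs \<in> tuples I2 n \<Longrightarrow> B xs (b xs)" by metis
  have mono: "B xs k \<Longrightarrow> k \<le> l \<Longrightarrow> B xs l" for xs k l
    unfolding B_def by (meson order_trans)
  have B_map: "B (map \<pi> xs) k" if \<pi>P: "\<pi> \<in> stab P" and B: "B xs k" for \<pi> xs k
  proof -
    have \<pi>: "\<pi> \<in> G2" using \<pi>P by (rule stab_G2)
    obtain \<delta> Q where *: "\<delta> \<in> preds two_Sigma_0 m" "\<Phi> xs \<delta>"
      "finite Q" "Q \<subseteq> I2" "card Q \<le> k" "supports Q \<delta>"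
      using B unfolding B_def by blast
    have "finite (\<pi> ` Q)" "\<pi> ` Q \<subseteq> I2" "card (\<pi> ` Q) \<le> k" "supports (\<pi> ` Q) (pred_act \<pi> \<delta>)"
      using * \<pi> card_image_le[of Q \<pi>] by (auto simp: G2_in_I2 supports_pred_act)
    then show ?thesis
      unfolding B_def using pred_act_preds[OF \<pi> *(1)] inv[OF \<pi>P *(2)] by blast
  qed
  have "finite N" using P by (simp add: N_def finite_pool)
  then have "finite (tuples N n)"
    using finite_lists_length_eq[of N n] by (simp add: tuples_def conj_commute)
  define k where "k = Max (b ` tuples N n)"
  have "N \<subseteq> I2" using P pool_I2 by (simp add: N_def)
  have "B xs k" if "xs \<in> tuples I2 n" for xs
    using that
  \<comment> \<open>Each exchange replaces one entry outside \<open>N\<close> by an element of the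
    pool, hence of \<open>N\<close>.\<close>
  proof (induction "card (set xs - N)" arbitrary: xs rule: less_induct)
    case less
    show ?case
    proof (cases "set xs \<subseteq> N")
      case True
      then have xs: "xs \<in> tuples N n" using less.prems by (simp add: tuples_def)
      then have "b xs \<le> k" unfolding k_def using \<open>finite (tuples N n)\<close> by simp
      with b[OF less.prems] show ?thesis by (rule mono)
    next
      case False
      then obtain a where a: "a \<in> set xs" "a \<notin> N" by blast
      with less.prems have "a \<in> I2" by (auto simp: tuples_def)
      have "card (P \<union> set xs) \<le> card P + n"
        using card_Un_le[of P "set xs"] card_length[of xs] less.prems by (simp add: tuples_def)
      then obtain r where r: "r \<in> pool (card P + n)" "r \<in> I2" "fst r = fst a" "r \<notin> P \<union> set xs"
        using fresh_in_pool[OF \<open>a \<in> I2\<close>, of "P \<union> set xs"] P(1) by auto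
      define \<pi> where "\<pi> = transpose a r"
      have \<pi>: "\<pi> \<in> stab P"
        unfolding \<pi>_def using a r \<open>a \<in> I2\<close> by (intro stab_transpose) (auto simp: N_def)
      have "\<pi> ` set xs - N = (set xs - N) - {a}"
        using a r by (auto simp: \<pi>_def N_def transpose_def)
      then have "card (set (map \<pi> xs) - N) < card (set xs - N)"
        using a by (metis card_Diff1_less DiffI finite_Diff finite_set list.set_map)
      then have "B (map \<pi> xs) k"
        using less.hyps map_tuples[OF stab_G2[OF \<pi>] less.prems] by blast
      \<comment> \<open>The transposition is its own inverse, so applying it again returns the bound
        to \<open>xs\<close>.\<close>
      then have "B (map \<pi> (map \<pi> xs)) k" by (rule B_map[OF \<pi>])
      then show ?thesis by (simp add: \<pi>_def comp_def)
    qed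
  qed
  with that show ?thesis unfolding B_def by blast
qed

text \<open>Here \<open>xs\<close> stays fixed and the solution moves: a transposition fixing
  \<open>P\<close> and \<open>xs\<close> turns solutions at \<open>xs\<close> into solutions at
  \<open>xs\<close>, while the support does not grow. Thus one pool, sized by the common bound,
  suffices for all tuples.\<close>

lemma uniform_support:
  assumes P: "finite P" "P \<subseteq> I2"
    and inv: "\<And>\<pi> xs \<delta>. \<pi> \<in> stab P \<Longrightarrow> \<Phi> xs \<delta> \<Longrightarrow> \<Phi> (map \<pi> xs) (pred_act \<pi> \<delta>)"
    and ex: "\<And>xs. xs \<in> tuples I2 n \<Longrightarrow> \<exists>\<delta>\<in>preds two_Sigma_0 m. \<Phi> xs \<delta>"
  obtains E where "finite E" "P \<subseteq> E" "E \<subseteq> I2" "\<forall>xs\<in>tuples I2 n.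
    \<exists>\<delta>\<in>preds two_Sigma_0 m. \<Phi> xs \<delta> \<and> supports (E \<union> set xs) \<delta>"
proof -
  obtain k where k: "\<forall>xs\<in>tuples I2 n.
    \<exists>\<delta>\<in>preds two_Sigma_0 m. \<Phi> xs \<delta> \<and> (\<exists>Q. finite Q \<and> Q \<subseteq> I2 \<and> card Q \<le> k \<and> supports Q \<delta>)"
    using bounded_supports[where \<Phi> = \<Phi>, OF assms] .
  define M where "M = k + card P + n"
  define E where "E = P \<union> pool M"
  have "\<exists>\<delta>\<in>preds two_Sigma_0 m. \<Phi> xs \<delta> \<and> supports (E \<union> set xs) \<delta>"
    if xs: "xs \<in> tuples I2 n" for xs
  proof -
    have move: "\<exists>\<delta>\<in>preds two_Sigma_0 m. \<Phi> xs \<delta> \<and> supports (E \<union> set xs) \<delta>"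
      if "\<delta> \<in> preds two_Sigma_0 m" "\<Phi> xs \<delta>" "finite Q" "Q \<subseteq> I2" "card Q \<le> k" "supports Q \<delta>" for \<delta> Q
      using that
    proof (induction "card (Q - (E \<union> set xs))" arbitrary: \<delta> Q rule: less_induct)
      case less
      show ?case
      proof (cases "Q \<subseteq> E \<union> set xs")
        case True
        with less.prems show ?thesis using supports_mono by blast
      next
        case False
        then obtain q where q: "q \<in> Q" "q \<notin> E" "q \<notin> set xs" by blast
        then have "q \<in> I2" using less.prems by blast
        let ?F = "Q \<union> P \<union> set xs"
        have "card ?F \<le> M"
          using card_Un_le[of "Q \<union> P" "set xs"] card_Un_le[of Q P] card_length[of xs] xs less.prems
          by (simp add: tuples_def M_def)
        \<comment> \<open>Avoiding \<open>P\<close> and \<open>set xs\<close> keeps the parameters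
          and the tuple fixed. Avoiding \<open>Q\<close> makes \<open>q\<close> disappear from the
          image of \<open>Q\<close>; with both points in \<open>Q\<close> that image would be
          \<open>Q\<close> itself.\<close>
        then obtain r where r: "r \<in> pool M" "r \<in> I2" "fst r = fst q" "r \<notin> ?F"
          using fresh_in_pool[OF \<open>q \<in> I2\<close>, of ?F] P(1) less.prems by auto
        define \<pi> where "\<pi> = transpose q r"
        have \<pi>: "\<pi> \<in> stab P"
          unfolding \<pi>_def using q r \<open>q \<in> I2\<close> by (intro stab_transpose) (auto simp: E_def)
        then have G: "\<pi> \<in> G2" by (rule stab_G2)
        have "map \<pi> xs = xs"
          using q r by (intro map_idI) (auto simp: \<pi>_def transpose_def)
        then have "\<Phi> xs (pred_act \<pi> \<delta>)" using inv[OF \<pi> less.prems(2)] by simp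
        moreover have "\<pi> ` Q - (E \<union> set xs) = (Q - (E \<union> set xs)) - {q}"
          using q r by (auto simp: \<pi>_def E_def transpose_def)
        then have "card (\<pi> ` Q - (E \<union> set xs)) < card (Q - (E \<union> set xs))"
          using q less.prems(3) by (metis card_Diff1_less DiffI Un_iff finite_Diff)
        moreover have "finite (\<pi> ` Q)" "\<pi> ` Q \<subseteq> I2" "card (\<pi> ` Q) \<le> k"
          using less.prems G card_image_le[of Q \<pi>] by (auto simp: G2_in_I2)
        ultimately show ?thesis
          using less.hyps pred_act_preds[OF G less.prems(1)] supports_pred_act[OF less.prems(6) G]
          by blast
      qed
    qed
    with k xs show ?thesis by blast
  qed
  moreover have "finite E" "P \<subseteq> E" "E \<subseteq> I2"
    using P pool_I2 by (auto simp: E_def finite_pool)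
  ultimately show ?thesis using that by blast
qed

text \<open>A solution is fixed at one representative of each orbit under \<open>stab E\<close> and
  transported along the orbit. The support \<open>E \<union> set xs\<close> from
  \<open>uniform_support\<close> makes the transport well defined, and the graph of the resulting
  selection is supported by \<open>E\<close>.\<close>

lemma uniformization:
  assumes P: "finite P" "P \<subseteq> I2"
    and inv: "\<And>\<pi> xs \<delta>. \<pi> \<in> stab P \<Longrightarrow> \<Phi> xs \<delta> \<Longrightarrow> \<Phi> (map \<pi> xs) (pred_act \<pi> \<delta>)"
    and ex: "\<And>xs. xs \<in> tuples I2 n \<Longrightarrow> \<exists>\<delta>\<in>preds two_Sigma_0 m. \<Phi> xs \<delta>"
  obtains \<sigma> where "\<sigma> \<in> preds two_Sigma_0 (n + m)" "\<forall>xs\<in>tuples I2 n.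
    (\<lambda>ys. \<sigma> (xs @ ys)) \<in> preds two_Sigma_0 m \<and> \<Phi> xs (\<lambda>ys. \<sigma> (xs @ ys))"
proof -
  obtain E where E: "finite E" "P \<subseteq> E" "E \<subseteq> I2" and "\<forall>xs\<in>tuples I2 n.
    \<exists>\<delta>\<in>preds two_Sigma_0 m. \<Phi> xs \<delta> \<and> supports (E \<union> set xs) \<delta>"
    using uniform_support[where \<Phi> = \<Phi>, OF assms] .
  then obtain d where d: "\<And>xs. xs \<in> tuples I2 n \<Longrightarrow> d xs \<in> preds two_Sigma_0 m"
    "\<And>xs. xs \<in> tuples I2 n \<Longrightarrow> \<Phi> xs (d xs)"
    "\<And>xs. xs \<in> tuples I2 n \<Longrightarrow> supports (E \<union> set xs) (d xs)"
    by metis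
  define orb where "orb xs = {map \<pi> xs |\<pi>. \<pi> \<in> stab E}" for xs
  \<comment> \<open>The choice depends on the orbit only as a set, so tuples in one orbit share
    their representative.\<close>
  define rep where "rep xs = (SOME zs. zs \<in> orb xs)" for xs
  have orb_map: "orb (map \<pi> xs) \<subseteq> orb xs" if "\<pi> \<in> stab E" for \<pi> xs
    using that by (auto simp: orb_def intro: stab_comp)
  have inv_map: "map (inv \<pi>) (map \<pi> xs) = xs" "map \<pi> (map (inv \<pi>) xs) = xs"
    if "\<pi> \<in> stab E" for \<pi> xs
    using stab_G2[OF that] by (simp_all add: comp_def)
  have rep_map: "rep (map \<pi> xs) = rep xs" if "\<pi> \<in> stab E" for \<pi> xs
  proof -
    have "orb xs \<subseteq> orb (map \<pi> xs)"
      using orb_map[OF stab_inv[OF that], of "map \<pi> xs"] by (simp only: inv_map[OF that])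
    with orb_map[OF that, of xs] have "orb (map \<pi> xs) = orb xs" by (rule subset_antisym)
    then show ?thesis by (simp add: rep_def)
  qed
  have ex_rep: "\<exists>\<pi>\<in>stab E. xs = map \<pi> (rep xs)" for xs
  proof -
    have "map id xs \<in> orb xs" unfolding orb_def using stab_id by blast
    then have "rep xs \<in> orb xs" unfolding rep_def by (rule someI)
    then obtain \<pi> where "\<pi> \<in> stab E" "rep xs = map \<pi> xs" by (auto simp: orb_def)
    then show ?thesis using stab_inv inv_map(1) by metis
  qed
  have rep_tuples: "rep xs \<in> tuples I2 n" if "xs \<in> tuples I2 n" for xs
    using ex_rep[of xs] that map_tuples[OF stab_G2[OF stab_inv]] inv_map(1) by metis
  define \<sigma> where "\<sigma> zs \<longleftrightarrow> (\<exists>xs ys \<pi>. zs = xs @ ys \<and> xs \<in> tuples I2 n \<and> \<pi> \<in> stab E \<and>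
    xs = map \<pi> (rep xs) \<and> pred_act \<pi> (d (rep xs)) ys)" for zs
  have \<sigma>_section: "(\<lambda>ys. \<sigma> (xs @ ys)) = pred_act \<pi> (d (rep xs))"
    if xs: "xs \<in> tuples I2 n" and \<pi>: "\<pi> \<in> stab E" "xs = map \<pi> (rep xs)" for xs \<pi>
  proof
    fix ys
    show "\<sigma> (xs @ ys) = pred_act \<pi> (d (rep xs)) ys"
    proof
      assume "\<sigma> (xs @ ys)"
      then obtain xs' ys' \<pi>' where *: "xs @ ys = xs' @ ys'" "xs' \<in> tuples I2 n" "\<pi>' \<in> stab E"
        "xs' = map \<pi>' (rep xs')" "pred_act \<pi>' (d (rep xs')) ys'"
        unfolding \<sigma>_def by blast
      have eq: "xs' = xs" "ys' = ys" using *(1,2) xs by (auto simp: tuples_def)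
      have G: "\<pi> \<in> G2" "\<pi>' \<in> G2" using \<pi>(1) *(3) by (auto intro: stab_G2)
      \<comment> \<open>Two transporting permutations differ by one that fixes \<open>E\<close> and
        each entry of \<open>rep xs\<close>, hence a support of \<open>d (rep xs)\<close>.\<close>
      have \<tau>: "inv \<pi> \<circ> \<pi>' \<in> stab E" using \<pi>(1) *(3) by (intro stab_comp stab_inv)
      have "map (inv \<pi> \<circ> \<pi>') (rep xs) = map (inv \<pi>) (map \<pi>' (rep xs))" by simp
      also have "\<dots> = map (inv \<pi>) (map \<pi> (rep xs))" using *(4) \<pi>(2) eq by simp
      also have "\<dots> = rep xs" by (rule inv_map(1)[OF \<pi>(1)])
      finally have "\<forall>p\<in>set (rep xs). (inv \<pi> \<circ> \<pi>') p = p" by (metis list.map_id id_apply map_eq_conv)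
      with \<tau> have "inv \<pi> \<circ> \<pi>' \<in> stab (E \<union> set (rep xs))" by (auto simp: stab_def)
      then have "pred_act (inv \<pi> \<circ> \<pi>') (d (rep xs)) = d (rep xs)"
        using d(3)[OF rep_tuples[OF xs]] by (simp add: supports_def)
      then have "pred_act \<pi>' (d (rep xs)) = pred_act \<pi> (d (rep xs))"
        using G by (metis G2_bij G2_inv pred_act_comp pred_act_inv(1))
      with *(5) eq show "pred_act \<pi> (d (rep xs)) ys" by simp
    next
      assume "pred_act \<pi> (d (rep xs)) ys"
      with that show "\<sigma> (xs @ ys)" unfolding \<sigma>_def by blast
    qed
  qed
  have sections: "(\<lambda>ys. \<sigma> (xs @ ys)) \<in> preds two_Sigma_0 m \<and> \<Phi> xs (\<lambda>ys. \<sigma> (xs @ ys))"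
    if xs: "xs \<in> tuples I2 n" for xs
  proof -
    obtain \<pi> where \<pi>: "\<pi> \<in> stab E" "xs = map \<pi> (rep xs)" using ex_rep by blast
    have "\<pi> \<in> stab P" using \<pi>(1) stab_mono[OF E(2)] by blast
    then have "\<Phi> (map \<pi> (rep xs)) (pred_act \<pi> (d (rep xs)))"
      by (intro inv d rep_tuples xs)
    moreover have "pred_act \<pi> (d (rep xs)) \<in> preds two_Sigma_0 m"
      using \<pi>(1) by (intro pred_act_preds d rep_tuples xs stab_G2)
    ultimately show ?thesis
      unfolding \<sigma>_section[OF xs \<pi>] using \<pi>(2) by simp
  qed
  have \<sigma>_map: "\<sigma> (map \<tau> zs)" if \<tau>: "\<tau> \<in> stab E" and zs: "\<sigma> zs" for \<tau> zs
  proof -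
    obtain xs ys \<pi> where *: "zs = xs @ ys" "xs \<in> tuples I2 n" "\<pi> \<in> stab E"
      "xs = map \<pi> (rep xs)" "pred_act \<pi> (d (rep xs)) ys"
      using zs unfolding \<sigma>_def by blast
    have G: "\<pi> \<in> G2" "\<tau> \<in> G2" using *(3) \<tau> by (auto intro: stab_G2)
    have "map \<tau> xs = map (\<tau> \<circ> \<pi>) (rep (map \<tau> xs))"
      using *(4) by (metis rep_map[OF \<tau>] map_map)
    moreover have "pred_act (\<tau> \<circ> \<pi>) (d (rep (map \<tau> xs))) (map \<tau> ys)"
      using *(5) G by (simp add: rep_map[OF \<tau>] pred_act_comp G2_bij pred_act_map G2_inj)
    ultimately show ?thesis
      unfolding \<sigma>_def using *(1,2) stab_comp[OF \<tau> *(3)] map_tuples[OF G(2) *(2)]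
      by (metis map_append)
  qed
  have "supports E \<sigma>"
    unfolding supports_def
  proof (intro ballI ext)
    fix \<tau> zs assume \<tau>: "\<tau> \<in> stab E"
    \<comment> \<open>The two implications come from \<open>\<sigma>_map\<close> for
      \<open>\<tau>\<close> and for its inverse.\<close>
    show "pred_act \<tau> \<sigma> zs = \<sigma> zs"
      unfolding pred_act_def using \<sigma>_map stab_inv[OF \<tau>] \<tau> inv_map(2)[OF \<tau>] by metis
  qed
  moreover have "\<sigma> \<in> nary_preds I2 (n + m)"
    unfolding nary_preds_def
  proof (intro CollectI allI impI)
    fix zs assume "\<sigma> zs"
    then obtain xs ys where *: "zs = xs @ ys" "xs \<in> tuples I2 n" unfolding \<sigma>_def by blast
    have "(\<lambda>ys. \<sigma> (xs @ ys)) \<in> nary_preds I2 m"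
      using sections[OF *(2)] by (simp add: preds_two_Sigma_0)
    with \<open>\<sigma> zs\<close> * have "length ys = m \<and> set ys \<subseteq> I2" unfolding nary_preds_def by blast
    with * show "length zs = n + m \<and> set zs \<subseteq> I2" by (simp add: tuples_def)
  qed
  ultimately have "\<sigma> \<in> preds two_Sigma_0 (n + m)"
    using E by (auto simp: preds_two_Sigma_0)
  with sections that show ?thesis by blast
qed

lemma two_Sigma_0_choice:
  assumes n: "n \<ge> 1"
  shows "models_set two_Sigma_0 (choice_h n m)"
proof -
  have "satisfies two_Sigma_0 e f (choice_h_form x y D S H)"
    if len: "length x = n" "length y = m" and dist: "distinct (x @ y)"
      and ar: "arity D = m" "arity S = n + m" and wf: "wf_form H" and S: "S \<notin> pvars H"
      and e: "\<And>v. e v \<in> I2" and f: "\<And>P. arity P \<ge> 1 \<Longrightarrow> f P \<in> preds two_Sigma_0 (arity P)"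
    for e f x y D S H
  proof -
    \<comment> \<open>The arities \<open>n + m\<close> and \<open>m\<close> differ because
      \<open>n \<ge> 1\<close>.\<close>
    have "S \<noteq> D" using ar n by auto
    \<comment> \<open>Membership in \<open>tuples\<close> is built in so that the equivariance proof
      knows the length of \<open>as\<close>, as \<open>upd_map\<close> requires.\<close>
    define \<Phi> where "\<Phi> as \<delta> \<longleftrightarrow> as \<in> tuples I2 n \<and>
      satisfies two_Sigma_0 (upd e x as) (f(D := \<delta>)) H" for as \<delta>
    have "\<exists>Q. finite Q \<and> Q \<subseteq> I2 \<and> supports Q (f R)" if "R \<in> pvars H" for R
      using f[OF wf_form_arity[OF wf that]] by (auto simp: preds_two_Sigma_0)
    then obtain supp where supp: "\<And>R. R \<in> pvars H \<Longrightarrow> finite (supp R)"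
      "\<And>R. R \<in> pvars H \<Longrightarrow> supp R \<subseteq> I2" "\<And>R. R \<in> pvars H \<Longrightarrow> supports (supp R) (f R)"
      by metis
    \<comment> \<open>A permutation fixing \<open>P\<close> fixes the values under \<open>e\<close>
      and \<open>f\<close> of all variables occurring in \<open>H\<close>, so it affects only the
      tuple assigned to \<open>x\<close> and the value of \<open>D\<close>.\<close>
    define P where "P = e ` ivars H \<union> \<Union> (supp ` pvars H)"
    have P: "finite P" "P \<subseteq> I2"
      unfolding P_def using supp e by (auto simp: finite_ivars finite_pvars)
    have inv: "\<Phi> (map \<pi> as) (pred_act \<pi> \<delta>)" if \<pi>: "\<pi> \<in> stab P" and \<Phi>: "\<Phi> as \<delta>" for \<pi> as \<delta>
    proof -
      have G: "\<pi> \<in> G2" using \<pi> by (rule stab_G2)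
      have as: "as \<in> tuples I2 n" using \<Phi> by (simp add: \<Phi>_def)
      have "satisfies two_Sigma_0 (upd e x as) (f(D := \<delta>)) H"
        using \<Phi> by (simp add: \<Phi>_def)
      then have "satisfies two_Sigma_0 (\<pi> \<circ> upd e x as) (\<lambda>Q. pred_act \<pi> ((f(D := \<delta>)) Q)) H"
        by (rule satisfies_pred_act[OF G, THEN iffD2])
      also have "?this \<longleftrightarrow>
        satisfies two_Sigma_0 (upd e x (map \<pi> as)) (f(D := pred_act \<pi> \<delta>)) H"
      proof (rule satisfies_cong)
        fix v assume v: "v \<in> ivars H"
        show "(\<pi> \<circ> upd e x as) v = upd e x (map \<pi> as) v"
        proof (cases "v \<in> set x")
          case True
          then show ?thesis
            using upd_map[of x as v e \<pi> e] dist len as by (simp add: tuples_def)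
        next
          case False
          moreover have "\<pi> (e v) = e v" using \<pi> v by (auto simp: stab_def P_def)
          ultimately show ?thesis by simp
        qed
      next
        fix R assume R: "R \<in> pvars H"
        have "supports P (f R)" using R by (intro supports_mono[OF supp(3)]) (auto simp: P_def)
        with \<pi> show "pred_act \<pi> ((f(D := \<delta>)) R) = (f(D := pred_act \<pi> \<delta>)) R"
          by (auto simp: supports_def)
      qed
      finally show ?thesis using map_tuples[OF G as] by (simp add: \<Phi>_def)
    qed
    show ?thesis
      unfolding choice_h_form_def satisfies.simps
    proof
      assume "satisfies two_Sigma_0 e f (AllIs x (ExP D H))"
      then have ex: "\<exists>\<delta>\<in>preds two_Sigma_0 m. \<Phi> as \<delta>" if "as \<in> tuples I2 n" for as
        using that dist len ar by (simp add: satisfies_AllIs \<Phi>_def)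
      obtain \<sigma> where \<sigma>: "\<sigma> \<in> preds two_Sigma_0 (n + m)" "\<forall>as\<in>tuples I2 n.
        (\<lambda>bs. \<sigma> (as @ bs)) \<in> preds two_Sigma_0 m \<and> \<Phi> as (\<lambda>bs. \<sigma> (as @ bs))"
        using uniformization[where \<Phi> = \<Phi>, OF P inv ex] .
      have "satisfies two_Sigma_0 (upd e x as) (f(S := \<sigma>, D := (\<lambda>bs. \<sigma> (as @ bs))))
        (Conj (AllIs y (Iff (Atom D y) (Atom S (x @ y)))) H)" if as: "as \<in> tuples I2 n" for as
      proof -
        have "satisfies two_Sigma_0 (upd e x as) (f(D := (\<lambda>bs. \<sigma> (as @ bs)))) H"
          using \<sigma>(2) as by (simp add: \<Phi>_def)
        \<comment> \<open>\<open>S\<close> does not occur in \<open>H\<close>, so assigning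
          \<open>\<sigma>\<close> to it leaves the truth of \<open>H\<close> unchanged.\<close>
        also have "?this \<longleftrightarrow>
          satisfies two_Sigma_0 (upd e x as) (f(S := \<sigma>, D := (\<lambda>bs. \<sigma> (as @ bs)))) H"
          using S by (intro satisfies_cong) auto
        finally show ?thesis
          using dist len as \<open>S \<noteq> D\<close>
          by (simp add: satisfies_AllIs map_upd_same Int_commute length_tuples cong: ball_cong_simp)
      qed
      with \<sigma> show "\<exists>\<alpha>\<in>preds two_Sigma_0 (arity S). satisfies two_Sigma_0 e (f(S := \<alpha>))
        (AllIs x (ExP D (Conj (AllIs y (Iff (Atom D y) (Atom S (x @ y)))) H)))"
        using dist len ar by (intro bexI[of _ \<sigma>]) (auto simp: satisfies_AllIs simp del: satisfies.simps(5))
    qed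
  qed
  then show ?thesis
    unfolding models_set_def models_def choice_h_def by fastforce
qed

theorem proposition5p2:
  "(\<forall>n\<ge>1. models two_Sigma_0 (Neg (TR n))) \<and>
   (\<forall>n\<ge>1. models two_Sigma_0 (Neg (LO n))) \<and>
   (\<forall>n\<ge>1. \<forall>m\<ge>1. models_set two_Sigma_0 (choice_h n m))"
  by (simp add: two_Sigma_0_not_TR two_Sigma_0_not_LO two_Sigma_0_choice)

end
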